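(* Let a base code on $n$ nodes be given, and consider any piggybacked version of $\alpha\ge 1$ instances of it. Then the minimum distance of the piggybacked code is at least the minimum distance of the base code. Moreover, if the base code is an $[n,k]$ MDS code, then the piggybacked code is also an $[n,k]$ MDS code.
   Context: Base code: $n$ encoding functions $f_1,\ldots,f_n$, each mapping a message $u$ (from a finite message set) to a value $f_i(u)$ in a finite-dimensional vector space $A_i$ over a finite field; node $i$ stores $f_i(u)$. Piggybacked version of $\alpha$ instances: the message is a tuple $(u_1,\ldots,u_\alpha)$ of messages of the base code. For arbitrary functions $g_{j,i}$ ($2\le j\le\alpha$, $1\le i\le n$) with values in $A_i$, node $i$ stores $$\bigl(f_i(u_1),\ f_i(u_2)+g_{2,i}(u_1),\ \ldots,\ f_i(u_\alpha)+g_{\alpha,i}(u_1,\ldots,u_{\alpha-1})\bigr),$$ optionally followed by an invertible linear transformation (depending on $i$) of the data stored in node $i$. Minimum distance: the entire content of one node is regarded as one coordinate; the minimum distance is the minimum, over pairs of distinct messages, of the number of nodes whose contents differ. An $[n,k]$ MDS code is one in which the message can be recovered from the contents of any $k$ of the $n$ nodes and each node has storage capacity $\frac1k$ of the size of the message. *)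

theory Defs
  imports Complex_Main "HOL-Library.Extended_Nat" "HOL-Library.FuncSet"
    "Jordan_Normal_Form.Missing_VectorSpace"
begin

text \<open>
  A storage code on the nodes \<open>1, \<dots>, n\<close> is given by a finite message set \<open>M\<close>, the sets \<open>S i\<close> of
  possible contents of node \<open>i\<close>, and the encoding functions \<open>c i\<close>.
\<close>

definition storage_code ::
  "nat \<Rightarrow> 'm set \<Rightarrow> (nat \<Rightarrow> 'v set) \<Rightarrow> (nat \<Rightarrow> 'm \<Rightarrow> 'v) \<Rightarrow> bool" where
  "storage_code n M S c \<longleftrightarrow> finite M \<and> (\<forall>i\<in>{1..n}. c i \<in> M \<rightarrow> S i)"

text \<open>
  The minimum is taken in \<^typ>\<open>enat\<close>, so that it is \<open>\<infinity>\<close> when there are no two distinct messages.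
\<close>

definition min_distance :: "nat \<Rightarrow> 'm set \<Rightarrow> (nat \<Rightarrow> 'm \<Rightarrow> 'v) \<Rightarrow> enat" where
  "min_distance n M c =
     (INF (u, v) \<in> {(u, v). u \<in> M \<and> v \<in> M \<and> u \<noteq> v}. enat (card {i \<in> {1..n}. c i u \<noteq> c i v}))"

definition recoverable_from :: "nat set \<Rightarrow> 'm set \<Rightarrow> (nat \<Rightarrow> 'm \<Rightarrow> 'v) \<Rightarrow> bool" where
  "recoverable_from I M c \<longleftrightarrow> (\<exists>D. \<forall>u\<in>M. D (\<lambda>i\<in>I. c i u) = u)"

text \<open>
  Sizes are measured in bits. Only their ratio matters: for a \<open>d\<close>-dimensional space over a field
  with \<open>q\<close> elements the value is \<open>d * log 2 q\<close>.
\<close>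

definition data_size :: "'x set \<Rightarrow> real" where
  "data_size X = log 2 (real (card X))"

definition mds_code ::
  "nat \<Rightarrow> nat \<Rightarrow> 'm set \<Rightarrow> (nat \<Rightarrow> 'v set) \<Rightarrow> (nat \<Rightarrow> 'm \<Rightarrow> 'v) \<Rightarrow> bool" where
  "mds_code n k M S c \<longleftrightarrow>
     1 \<le> k \<and> k \<le> n \<and> storage_code n M S c \<and>
     (\<forall>I. I \<subseteq> {1..n} \<and> card I = k \<longrightarrow> recoverable_from I M c) \<and>
     (\<forall>i\<in>{1..n}. data_size (S i) = data_size M / real k)"

text \<open>
  The space \<open>V\<^sup>m\<close>, with vectors indexed by \<open>{1..m}\<close>. The fields \<open>mult\<close> and \<open>one\<close> are part of the
  record type but play no role in a module.
\<close>

definition module_power ::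
  "('k, 'v, 'c) module_scheme \<Rightarrow> nat \<Rightarrow> ('k, nat \<Rightarrow> 'v) module" where
  "module_power V m =
     \<lparr>carrier = {1..m} \<rightarrow>\<^sub>E carrier V,
      mult = (\<lambda>x y. \<lambda>j\<in>{1..m}. \<zero>\<^bsub>V\<^esub>),
      one = (\<lambda>j\<in>{1..m}. \<zero>\<^bsub>V\<^esub>),
      zero = (\<lambda>j\<in>{1..m}. \<zero>\<^bsub>V\<^esub>),
      add = (\<lambda>x y. \<lambda>j\<in>{1..m}. x j \<oplus>\<^bsub>V\<^esub> y j),
      smult = (\<lambda>a x. \<lambda>j\<in>{1..m}. a \<odot>\<^bsub>V\<^esub> x j)\<rparr>"

lemma vectorspace_module_power:
  assumes "vectorspace K V"
  shows "vectorspace K (module_power V m)"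
proof -
  interpret vectorspace K V by fact
  have mem: "x j \<in> carrier V" if "x \<in> {1..m} \<rightarrow>\<^sub>E carrier V" "1 \<le> j" "j \<le> m" for x j
    using that by auto
  have undef: "x j = undefined" if "x \<in> {1..m} \<rightarrow>\<^sub>E carrier V" "1 \<le> j \<longrightarrow> \<not> j \<le> m" for x j
    using that by (auto simp: PiE_iff extensional_def)
  have grp: "abelian_group (module_power V m)"
  proof (rule abelian_groupI)
    fix x
    assume x: "x \<in> carrier (module_power V m)"
    show "\<exists>y\<in>carrier (module_power V m). y \<oplus>\<^bsub>module_power V m\<^esub> x = \<zero>\<^bsub>module_power V m\<^esub>"
      by (rule bexI[where x = "\<lambda>j\<in>{1..m}. \<ominus>\<^bsub>V\<^esub> x j"])
        (use x in \<open>auto simp: module_power_def mem M.l_neg fun_eq_iff\<close>)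
  qed (auto simp: module_power_def mem undef M.a_ac fun_eq_iff)
  have "module K (module_power V m)"
    by (rule moduleI[OF R.is_cring grp])
      (auto simp: module_power_def mem undef fun_eq_iff smult_l_distr smult_r_distr smult_assoc1)
  then show ?thesis
    by (simp add: vectorspace_def field_axioms)
qed

text \<open>
  The messages of \<open>\<alpha>\<close> instances are the tuples \<open>us \<in> {1..\<alpha>} \<rightarrow>\<^sub>E U\<close>, and \<open>g j i\<close> is applied to the
  initial segment of \<open>us\<close> on \<open>{1..<j}\<close>.
\<close>

definition piggyback_functions ::
  "nat \<Rightarrow> (nat \<Rightarrow> ('k, 'v, 'c) module_scheme) \<Rightarrow> 'm set \<Rightarrow> nat
    \<Rightarrow> (nat \<Rightarrow> nat \<Rightarrow> (nat \<Rightarrow> 'm) \<Rightarrow> 'v) \<Rightarrow> bool" where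
  "piggyback_functions n A U \<alpha> g \<longleftrightarrow>
     (\<forall>j\<in>{2..\<alpha>}. \<forall>i\<in>{1..n}. g j i \<in> ({1..<j} \<rightarrow>\<^sub>E U) \<rightarrow> carrier (A i))"

text \<open>
  A node whose data is not transformed is the case where \<open>T i\<close> is the identity.
\<close>

definition node_transformations ::
  "nat \<Rightarrow> ('k, 'a) ring_scheme \<Rightarrow> (nat \<Rightarrow> ('k, 'v, 'c) module_scheme) \<Rightarrow> nat
    \<Rightarrow> (nat \<Rightarrow> (nat \<Rightarrow> 'v) \<Rightarrow> (nat \<Rightarrow> 'v)) \<Rightarrow> bool" where
  "node_transformations n K A \<alpha> T \<longleftrightarrow>
     (\<forall>i\<in>{1..n}.
        linear_map K (module_power (A i) \<alpha>) (module_power (A i) \<alpha>) (T i) \<and>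
        bij_betw (T i) (carrier (module_power (A i) \<alpha>)) (carrier (module_power (A i) \<alpha>)))"

definition piggyback ::
  "(nat \<Rightarrow> ('k, 'v, 'c) module_scheme) \<Rightarrow> (nat \<Rightarrow> 'm \<Rightarrow> 'v) \<Rightarrow> nat
    \<Rightarrow> (nat \<Rightarrow> nat \<Rightarrow> (nat \<Rightarrow> 'm) \<Rightarrow> 'v) \<Rightarrow> (nat \<Rightarrow> (nat \<Rightarrow> 'v) \<Rightarrow> (nat \<Rightarrow> 'v))
    \<Rightarrow> nat \<Rightarrow> (nat \<Rightarrow> 'm) \<Rightarrow> (nat \<Rightarrow> 'v)" where
  "piggyback A f \<alpha> g T i us =
     T i (\<lambda>j\<in>{1..\<alpha>}. if j = 1 then f i (us 1)
                     else f i (us j) \<oplus>\<^bsub>A i\<^esub> g j i (restrict us {1..<j}))"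

end

theory Submission
  imports Defs
begin

text \<open>
  Two distinct tuples of messages first differ in some instance \<open>j\<close>. Their piggybacks in that
  instance agree, since they only depend on the earlier instances. So every node that
  distinguishes the \<open>j\<close>-th messages in the base code also distinguishes the two tuples in the
  piggybacked code. The distance bound and the recovery property both follow from this, the latter
  because a message is recoverable from a set of nodes iff these nodes separate all messages.
\<close>

text \<open>A decoder is a left inverse on \<open>M\<close> of the joint encoding map, and one
  exists exactly when that map is injective on \<open>M\<close>; \<open>inv_into\<close> supplies
  it.\<close>

lemma recoverable_from_iff_separating:
  "recoverable_from I M c \<longleftrightarrow> (\<forall>u\<in>M. \<forall>v\<in>M. u \<noteq> v \<longrightarrow> (\<exists>i\<in>I. c i u \<noteq> c i v))"
    (is "_ \<longleftrightarrow> ?sep")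
proof
  assume "recoverable_from I M c"
  then obtain D where D: "\<And>u. u \<in> M \<Longrightarrow> D (\<lambda>i\<in>I. c i u) = u"
    unfolding recoverable_from_def by blast
  show ?sep
  proof (intro ballI impI, rule ccontr)
    fix u v
    assume "u \<in> M" "v \<in> M" "u \<noteq> v" and "\<not> (\<exists>i\<in>I. c i u \<noteq> c i v)"
    then have "(\<lambda>i\<in>I. c i u) = (\<lambda>i\<in>I. c i v)"
      by (auto intro: restrict_ext)
    then show False
      using D \<open>u \<in> M\<close> \<open>v \<in> M\<close> \<open>u \<noteq> v\<close> by metis
  qed
next
  assume sep: ?sep
  have "inj_on (\<lambda>u. \<lambda>i\<in>I. c i u) M"
  proof (rule inj_onI, rule ccontr)
    fix u v
    assume "u \<in> M" "v \<in> M" "u \<noteq> v" and eq: "(\<lambda>i\<in>I. c i u) = (\<lambda>i\<in>I. c i v)"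
    then obtain i where "i \<in> I" "c i u \<noteq> c i v"
      using sep by blast
    then show False
      using fun_cong[OF eq, of i] by simp
  qed
  then show "recoverable_from I M c"
    unfolding recoverable_from_def by (blast dest: inv_into_f_f)
qed

text \<open>The logarithm turns the power \<open>card X ^ m\<close> into a multiple. Empty and
  infinite \<open>X\<close> both have \<open>card X = 0\<close>, where the convention that the
  logarithm of 0 is 0 keeps the equation true.\<close>

lemma data_size_PiE_const:
  "data_size ({1..m} \<rightarrow>\<^sub>E X) = real m * data_size X"
proof (cases "card X = 0")
  case True
  then show ?thesis
    by (cases m) (simp_all add: data_size_def card_PiE log_def)
next
  case False
  then show ?thesis
    by (simp add: data_size_def card_PiE log_nat_power)
qed

lemma restrict_PiE_subset:
  assumes "x \<in> S \<rightarrow>\<^sub>E X" "S' \<subseteq> S"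
  shows "restrict x S' \<in> S' \<rightarrow>\<^sub>E X"
  using assms by (intro restrict_PiE_iff[THEN iffD2] ballI PiE_mem[OF assms(1)]) blast

text \<open>This serves twice: it makes the stored data legal node contents, and it places them
  where \<open>T i\<close> is known to be injective.\<close>

lemma (in abelian_group) piggyback_data_in_carrier:
  fixes \<alpha> :: nat
  assumes "\<And>u. u \<in> U \<Longrightarrow> f u \<in> carrier G"
    and "\<And>j. j \<in> {2..\<alpha>} \<Longrightarrow> g j \<in> ({1..<j} \<rightarrow>\<^sub>E U) \<rightarrow> carrier G"
    and "us \<in> {1..\<alpha>} \<rightarrow>\<^sub>E U"
  shows "(\<lambda>j\<in>{1..\<alpha>}. if j = 1 then f (us 1) else f (us j) \<oplus> g j (restrict us {1..<j}))
    \<in> {1..\<alpha>} \<rightarrow>\<^sub>E carrier G"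
proof (rule restrict_PiE_iff[THEN iffD2], intro ballI)
  fix j
  assume j: "j \<in> {1..\<alpha>}"
  then have "restrict us {1..<j} \<in> {1..<j} \<rightarrow>\<^sub>E U"
    by (intro restrict_PiE_subset[OF assms(3)]) auto
  then have "g j (restrict us {1..<j}) \<in> carrier G" if "j \<noteq> 1"
    using assms(2)[of j] j that by (auto simp: Pi_iff)
  moreover have "f (us j) \<in> carrier G"
    using assms(1,3) j by blast
  ultimately show "(if j = 1 then f (us 1) else f (us j) \<oplus> g j (restrict us {1..<j})) \<in> carrier G"
    by auto
qed

lemma first_difference:
  fixes us vs :: "nat \<Rightarrow> 'm"
  assumes "us \<in> {1..m} \<rightarrow>\<^sub>E U" "vs \<in> {1..m} \<rightarrow>\<^sub>E U" "us \<noteq> vs"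
  obtains j where "j \<in> {1..m}" "us j \<noteq> vs j" "restrict us {1..<j} = restrict vs {1..<j}"
proof -
  \<comment> \<open>The minimum may range over all naturals: outside \<open>{1..m}\<close> both
    tuples are \<open>undefined\<close>, so they can only differ inside.\<close>
  define j where "j = (LEAST j. us j \<noteq> vs j)"
  have "\<exists>j. us j \<noteq> vs j"
    using assms(3) by blast
  then have j: "us j \<noteq> vs j"
    unfolding j_def by (rule LeastI_ex)
  moreover have "j \<in> {1..m}"
    using j PiE_arb[OF assms(1)] PiE_arb[OF assms(2)] by metis
  moreover have "us l = vs l" if "l < j" for l
    using not_less_Least that unfolding j_def by blast
  then have "restrict us {1..<j} = restrict vs {1..<j}"
    by (intro restrict_ext) simp
  ultimately show ?thesis
    using that by blast
qed

text \<open>The pair \<open>u\<close>, \<open>w\<close> consists of the entries at the first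
  difference of the tuples. It is chosen before the node \<open>i\<close>, so one base pair serves
  all nodes at once; this allows whole sets of distinguishing nodes to be compared.\<close>

lemma piggyback_inherits_separation:
  fixes K :: "('k, 'a) ring_scheme" and A :: "nat \<Rightarrow> ('k, 'v, 'c) module_scheme"
  assumes vs: "\<And>i. i \<in> {1..n} \<Longrightarrow> vectorspace K (A i)"
    and code: "storage_code n U (\<lambda>i. carrier (A i)) f"
    and pig: "piggyback_functions n A U \<alpha> g"
    and trans: "node_transformations n K A \<alpha> T"
    and us: "us \<in> {1..\<alpha>} \<rightarrow>\<^sub>E U" and ws: "ws \<in> {1..\<alpha>} \<rightarrow>\<^sub>E U" and neq: "us \<noteq> ws"
  obtains u w where "u \<in> U" "w \<in> U" "u \<noteq> w"
    "\<And>i. i \<in> {1..n} \<Longrightarrow> f i u \<noteq> f i w \<Longrightarrow> piggyback A f \<alpha> g T i us \<noteq> piggyback A f \<alpha> g T i ws"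
proof -
  obtain j where j: "j \<in> {1..\<alpha>}" "us j \<noteq> ws j" "restrict us {1..<j} = restrict ws {1..<j}"
    using first_difference[OF us ws neq] .
  have mem: "us j \<in> U" "ws j \<in> U"
    using us ws j(1) by auto
  moreover have "piggyback A f \<alpha> g T i us \<noteq> piggyback A f \<alpha> g T i ws"
    if i: "i \<in> {1..n}" and f_neq: "f i (us j) \<noteq> f i (ws j)" for i
  proof
    interpret vectorspace K "A i"
      using vs[OF i] .
    \<comment> \<open>The content of node \<open>i\<close> before \<open>T i\<close> is applied.
      Injectivity of \<open>T i\<close> on the carrier reduces equal contents to equal
      \<open>d\<close>, of which only coordinate \<open>j\<close> is needed.\<close>
    define d where "d = (\<lambda>us. \<lambda>j\<in>{1..\<alpha>}. if j = 1 then f i (us 1)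
      else f i (us j) \<oplus>\<^bsub>A i\<^esub> g j i (restrict us {1..<j}))"
    have f_in: "f i u \<in> carrier (A i)" if "u \<in> U" for u
      using code i that by (auto simp: storage_code_def)
    have g_in: "g l i \<in> ({1..<l} \<rightarrow>\<^sub>E U) \<rightarrow> carrier (A i)" if "l \<in> {2..\<alpha>}" for l
      using pig i that by (auto simp: piggyback_functions_def)
    have d_in: "d us \<in> carrier (module_power (A i) \<alpha>)" if "us \<in> {1..\<alpha>} \<rightarrow>\<^sub>E U" for us
      using M.piggyback_data_in_carrier[of U "f i" \<alpha> "\<lambda>l. g l i", OF f_in g_in that]
      by (simp add: d_def module_power_def)
    assume "piggyback A f \<alpha> g T i us = piggyback A f \<alpha> g T i ws"
    then have "T i (d us) = T i (d ws)"
      by (simp add: piggyback_def d_def)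
    moreover have "inj_on (T i) (carrier (module_power (A i) \<alpha>))"
      using trans i by (auto simp: node_transformations_def bij_betw_def)
    ultimately have "d us = d ws"
      using d_in[OF us] d_in[OF ws] by (auto dest: inj_onD)
    then have d_eq: "d us j = d ws j"
      by simp
    show False
    proof (cases "j = 1")
      case True
      then show False
        using d_eq j(1) f_neq by (simp add: d_def)
    next
      case False
      \<comment> \<open>Both tuples have the same prefix, so the same piggyback is added to
        \<open>f i (us j)\<close> and \<open>f i (ws j)\<close>. Once it is known to lie in
        \<open>A i\<close> it cancels, contradicting \<open>f_neq\<close>.\<close>
      have "restrict us {1..<j} \<in> {1..<j} \<rightarrow>\<^sub>E U"
        using j(1) by (intro restrict_PiE_subset[OF us]) auto
      then have "g j i (restrict us {1..<j}) \<in> carrier (A i)"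
        using g_in[of j] j(1) False by (auto simp: Pi_iff)
      then show False
        using d_eq j(1,3) False f_neq f_in[OF mem(1)] f_in[OF mem(2)]
        by (simp add: d_def)
    qed
  qed
  ultimately show ?thesis
    using that j(2) by blast
qed

lemma storage_code_piggyback:
  fixes K :: "('k, 'a) ring_scheme" and A :: "nat \<Rightarrow> ('k, 'v, 'c) module_scheme"
  assumes vs: "\<And>i. i \<in> {1..n} \<Longrightarrow> vectorspace K (A i)"
    and code: "storage_code n U (\<lambda>i. carrier (A i)) f"
    and pig: "piggyback_functions n A U \<alpha> g"
    and trans: "node_transformations n K A \<alpha> T"
  shows "storage_code n ({1..\<alpha>} \<rightarrow>\<^sub>E U) (\<lambda>i. carrier (module_power (A i) \<alpha>)) (piggyback A f \<alpha> g T)"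
  unfolding storage_code_def
proof (intro conjI ballI funcsetI)
  show "finite ({1..\<alpha>} \<rightarrow>\<^sub>E U)"
    using code by (simp add: storage_code_def finite_PiE)
next
  fix i us
  assume i: "i \<in> {1..n}" and us: "us \<in> {1..\<alpha>} \<rightarrow>\<^sub>E U"
  interpret vectorspace K "A i"
    using vs[OF i] .
  have f_in: "f i u \<in> carrier (A i)" if "u \<in> U" for u
    using code i that by (auto simp: storage_code_def)
  have g_in: "g l i \<in> ({1..<l} \<rightarrow>\<^sub>E U) \<rightarrow> carrier (A i)" if "l \<in> {2..\<alpha>}" for l
    using pig i that by (auto simp: piggyback_functions_def)
  \<comment> \<open>The transformation maps the space of node contents onto itself, so it does not
    enlarge the storage of a node.\<close>
  have "T i ` carrier (module_power (A i) \<alpha>) = carrier (module_power (A i) \<alpha>)"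
    using trans i by (auto simp: node_transformations_def bij_betw_def)
  then show "piggyback A f \<alpha> g T i us \<in> carrier (module_power (A i) \<alpha>)"
    using M.piggyback_data_in_carrier[of U "f i" \<alpha> "\<lambda>l. g l i", OF f_in g_in us]
    unfolding piggyback_def by (auto simp only: module_power_def partial_object.simps)
qed

theorem corollary2:
  fixes K :: "('k, 'a) ring_scheme"
    and A :: "nat \<Rightarrow> ('k, 'v, 'c) module_scheme"
    and U :: "'m set"
    and f :: "nat \<Rightarrow> 'm \<Rightarrow> 'v"
    and n \<alpha> :: nat
    and g :: "nat \<Rightarrow> nat \<Rightarrow> (nat \<Rightarrow> 'm) \<Rightarrow> 'v"
    and T :: "nat \<Rightarrow> (nat \<Rightarrow> 'v) \<Rightarrow> (nat \<Rightarrow> 'v)"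
  assumes "field K" and "finite (carrier K)"
    and "\<And>i. i \<in> {1..n} \<Longrightarrow> vectorspace K (A i)"
    and "\<And>i. i \<in> {1..n} \<Longrightarrow> vectorspace.fin_dim K (A i)"
    and "storage_code n U (\<lambda>i. carrier (A i)) f"
    and "\<alpha> \<ge> 1"
    and "piggyback_functions n A U \<alpha> g"
    and "node_transformations n K A \<alpha> T"
  shows "min_distance n U f \<le> min_distance n ({1..\<alpha>} \<rightarrow>\<^sub>E U) (piggyback A f \<alpha> g T) \<and>
    (\<forall>k. mds_code n k U (\<lambda>i. carrier (A i)) f \<longrightarrow>
      mds_code n k ({1..\<alpha>} \<rightarrow>\<^sub>E U) (\<lambda>i. carrier (module_power (A i) \<alpha>)) (piggyback A f \<alpha> g T))"
proof (intro conjI allI impI)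
  note separation = piggyback_inherits_separation[OF assms(3,5,7,8)]
  show "min_distance n U f \<le> min_distance n ({1..\<alpha>} \<rightarrow>\<^sub>E U) (piggyback A f \<alpha> g T)"
    unfolding min_distance_def
  \<comment> \<open>It suffices to match each pair of tuples with a base pair of no larger distance.
    If there are no two distinct tuples, the right-hand infimum is
    \<open>\<infinity>\<close>.\<close>
  proof (rule INF_mono, clarify)
    fix us ws
    assume "us \<in> {1..\<alpha>} \<rightarrow>\<^sub>E U" "ws \<in> {1..\<alpha>} \<rightarrow>\<^sub>E U" "us \<noteq> ws"
    then obtain u w where "u \<in> U" "w \<in> U" "u \<noteq> w"
      and "\<And>i. i \<in> {1..n} \<Longrightarrow> f i u \<noteq> f i w \<Longrightarrow>
        piggyback A f \<alpha> g T i us \<noteq> piggyback A f \<alpha> g T i ws"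
      using separation by metis
    then show "\<exists>p\<in>{(u, v). u \<in> U \<and> v \<in> U \<and> u \<noteq> v}.
        (case p of (u, v) \<Rightarrow> enat (card {i \<in> {1..n}. f i u \<noteq> f i v}))
        \<le> enat (card {i \<in> {1..n}. piggyback A f \<alpha> g T i us \<noteq> piggyback A f \<alpha> g T i ws})"
      \<comment> \<open>The nodes distinguishing \<open>u\<close> from \<open>w\<close> form a
        subset of those distinguishing the tuples.\<close>
      by (intro bexI[of _ "(u, w)"]) (auto intro!: card_mono)
  qed
next
  fix k
  note separation = piggyback_inherits_separation[OF assms(3,5,7,8)]
  assume mds: "mds_code n k U (\<lambda>i. carrier (A i)) f"
  have "recoverable_from I ({1..\<alpha>} \<rightarrow>\<^sub>E U) (piggyback A f \<alpha> g T)"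
    if I: "I \<subseteq> {1..n}" "card I = k" for I
    unfolding recoverable_from_iff_separating
  proof (intro ballI impI)
    fix us ws
    assume "us \<in> {1..\<alpha>} \<rightarrow>\<^sub>E U" "ws \<in> {1..\<alpha>} \<rightarrow>\<^sub>E U" "us \<noteq> ws"
    then obtain u w where "u \<in> U" "w \<in> U" "u \<noteq> w"
      and sep: "\<And>i. i \<in> {1..n} \<Longrightarrow> f i u \<noteq> f i w \<Longrightarrow>
        piggyback A f \<alpha> g T i us \<noteq> piggyback A f \<alpha> g T i ws"
      using separation by metis
    moreover have "recoverable_from I U f"
      using mds I by (simp add: mds_code_def)
    \<comment> \<open>Recoverability in the base code puts a distinguishing node inside
      \<open>I\<close> itself, and that same node tells the tuples apart.\<close>
    ultimately obtain i where "i \<in> I" "f i u \<noteq> f i w"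
      unfolding recoverable_from_iff_separating by blast
    then show "\<exists>i\<in>I. piggyback A f \<alpha> g T i us \<noteq> piggyback A f \<alpha> g T i ws"
      using sep I(1) by blast
  qed
  \<comment> \<open>Node capacity and message size are both multiplied by \<alpha>, so their ratio
    stays \<open>1 / k\<close>.\<close>
  moreover have "data_size (carrier (module_power (A i) \<alpha>)) = data_size ({1..\<alpha>} \<rightarrow>\<^sub>E U) / real k"
    if "i \<in> {1..n}" for i
    using mds that unfolding mds_code_def module_power_def by (simp add: data_size_PiE_const del: One_nat_def)
  ultimately show "mds_code n k ({1..\<alpha>} \<rightarrow>\<^sub>E U) (\<lambda>i. carrier (module_power (A i) \<alpha>))
      (piggyback A f \<alpha> g T)"
    using mds storage_code_piggyback[OF assms(3,5,7,8)] by (simp add: mds_code_def)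
qed

end
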